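(* Let $k$ be a positive integer. If $\mathcal{F}$ is a finite family of subsets of a finite set $U=[m]$ with $|\mathbf{ID}(\mathcal{F})| = k$, then there exists a monotone DNF formula over the variables $x_1,\dots,x_m$ with exactly $k$ satisfying assignments, namely the formula $\bigvee_{S\in\mathcal{F}} \bigwedge_{i\in U\setminus S} x_i$ (one term for each member of $\mathcal{F}$). In particular, a monotone DNF formula with the smallest number of terms among all monotone DNF formulas having exactly $k$ satisfying assignments has $\alpha(k)$ terms.
   Context: For a finite family $\mathcal{S}=\{S_1,\dots,S_t\}$ of finite sets, the ideal generated by $\mathcal{S}$ is $\mathbf{ID}(\mathcal{S})=2^{S_1}\cup\cdots\cup 2^{S_t}$, i.e. the family of all sets contained in some member of $\mathcal{S}$. For a positive integer $k$, $\alpha(k)$ is the minimum of $|\mathcal{S}|$ over all finite families $\mathcal{S}$ of finite sets with $|\mathbf{ID}(\mathcal{S})|=k$. A monotone DNF formula is a disjunction of terms, each term being a conjunction of variables (no negated literals). Satisfying assignments are counted among all truth assignments to the full variable set $x_1,\dots,x_m$, including variables not occurring in the formula. *)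

theory Defs
  imports "HOL-Library.FuncSet"
begin

definition ID :: "'a set set \<Rightarrow> 'a set set" where
  "ID F = (\<Union>S\<in>F. Pow S)"

(* Every finite family of finite sets is isomorphic to a family of sets of natural numbers, so
   taking nat as the universe of elements loses nothing. *)
definition alpha :: "nat \<Rightarrow> nat" where
  "alpha k = (LEAST t. \<exists>F :: nat set set.
     finite F \<and> (\<forall>S\<in>F. finite S) \<and> card (ID F) = k \<and> card F = t)"

(* A term (conjunction of variables) is the set of indices of its variables, and a monotone DNF
   formula is the finite set of its terms. The empty term is the constant true, and the empty
   formula is the constant false. *)
type_synonym mdnf = "nat set set"

definition mdnf_over :: "nat \<Rightarrow> mdnf \<Rightarrow> bool" where
  "mdnf_over m \<phi> \<longleftrightarrow> finite \<phi> \<and> (\<forall>T\<in>\<phi>. T \<subseteq> {1..m})"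

definition satisfies :: "(nat \<Rightarrow> bool) \<Rightarrow> mdnf \<Rightarrow> bool" where
  "satisfies a \<phi> \<longleftrightarrow> (\<exists>T\<in>\<phi>. \<forall>i\<in>T. a i)"

(* The extensional function space makes each assignment to the variables 1..m occur exactly once. *)
definition sat_assignments :: "nat \<Rightarrow> mdnf \<Rightarrow> (nat \<Rightarrow> bool) set" where
  "sat_assignments m \<phi> = {a \<in> {1..m} \<rightarrow>\<^sub>E (UNIV :: bool set). satisfies a \<phi>}"

definition family_mdnf :: "nat \<Rightarrow> nat set set \<Rightarrow> mdnf" where
  "family_mdnf m F = (\<lambda>S. {1..m} - S) ` F"

(* Minimality ranges over formulas in any number n of variables, not just over those in the same
   m variables. *)
definition min_mdnf :: "nat \<Rightarrow> nat \<Rightarrow> mdnf \<Rightarrow> bool" where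
  "min_mdnf k m \<phi> \<longleftrightarrow>
     mdnf_over m \<phi> \<and> card (sat_assignments m \<phi>) = k \<and>
     (\<forall>n \<psi>. mdnf_over n \<psi> \<and> card (sat_assignments n \<psi>) = k \<longrightarrow> card \<phi> \<le> card \<psi>)"

end

theory Submission
  imports Defs
begin

text \<open>Sending an assignment to the set of its false variables identifies the satisfying assignments
  of \<^term>\<open>family_mdnf m F\<close> with \<^term>\<open>ID F\<close>: the term of \<open>S\<close> holds iff every false variable lies
  in \<open>S\<close>. As complementation in \<open>{1..m}\<close> is an involution, every monotone DNF formula arises
  in this way.\<close>

text \<open>Complementation in \<open>{1..m}\<close> is injective on subsets of
  \<open>{1..m}\<close>, so distinct members of \<open>F\<close> never collapse into one
  term.\<close>

lemma card_family_mdnf: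
  assumes "F \<subseteq> Pow {1..m}"
  shows "card (family_mdnf m F) = card F"
proof -
  have "inj_on (\<lambda>S. {1..m} - S) F"
    using assms by (intro inj_onI) blast
  then show ?thesis
    unfolding family_mdnf_def by (rule card_image)
qed

lemma family_mdnf_involution:
  assumes "F \<subseteq> Pow {1..m}"
  shows "family_mdnf m (family_mdnf m F) = F"
proof -
  have "{1..m} - ({1..m} - S) = S" if "S \<in> F" for S
    using assms that by blast
  then show ?thesis
    by (simp add: family_mdnf_def image_image)
qed

lemma mdnf_over_family_mdnf: "finite F \<Longrightarrow> mdnf_over m (family_mdnf m F)"
  by (auto simp: mdnf_over_def family_mdnf_def)

lemma card_sat_assignments_family_mdnf:
  assumes "F \<subseteq> Pow {1..m}"
  shows "card (sat_assignments m (family_mdnf m F)) = card (ID F)"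
proof -
  have "bij_betw (\<lambda>a. {i \<in> {1..m}. \<not> a i}) (sat_assignments m (family_mdnf m F)) (ID F)"
  \<comment> \<open>The inverse makes exactly the elements of \<open>A\<close> false. The restricted
    abstraction is \<open>undefined\<close> outside \<open>{1..m}\<close>, as the extensional
    function space demands.\<close>
  proof (rule bij_betw_byWitness[where f' = "\<lambda>A. \<lambda>i\<in>{1..m}. i \<notin> A"])
    show "\<forall>a\<in>sat_assignments m (family_mdnf m F).
        (\<lambda>i\<in>{1..m}. i \<notin> {i \<in> {1..m}. \<not> a i}) = a"
      by (auto simp: sat_assignments_def PiE_iff extensional_def fun_eq_iff)
    \<comment> \<open>Recovering all of \<open>A\<close> relies on \<open>A\<close> lying inside
      \<open>{1..m}\<close>, which it inherits from a member of \<open>F\<close>.\<close>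
    show "\<forall>A\<in>ID F. {i \<in> {1..m}. \<not> (\<lambda>i\<in>{1..m}. i \<notin> A) i} = A"
      using assms by (fastforce simp: ID_def)
    show "(\<lambda>a. {i \<in> {1..m}. \<not> a i}) ` sat_assignments m (family_mdnf m F) \<subseteq> ID F"
    proof (rule image_subsetI)
      fix a assume "a \<in> sat_assignments m (family_mdnf m F)"
      then obtain S where "S \<in> F" "\<forall>i\<in>{1..m} - S. a i"
        unfolding sat_assignments_def satisfies_def family_mdnf_def by blast
      then show "{i \<in> {1..m}. \<not> a i} \<in> ID F"
        unfolding ID_def by blast
    qed
    show "(\<lambda>A. \<lambda>i\<in>{1..m}. i \<notin> A) ` ID F \<subseteq> sat_assignments m (family_mdnf m F)"
    proof (rule image_subsetI)
      fix A assume "A \<in> ID F"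
      then obtain S where "S \<in> F" "A \<subseteq> S"
        unfolding ID_def by blast
      then have "\<forall>i\<in>{1..m} - S. (\<lambda>i\<in>{1..m}. i \<notin> A) i"
        by auto
      then have "satisfies (\<lambda>i\<in>{1..m}. i \<notin> A) (family_mdnf m F)"
        unfolding satisfies_def family_mdnf_def using \<open>S \<in> F\<close> by blast
      then show "(\<lambda>i\<in>{1..m}. i \<notin> A) \<in> sat_assignments m (family_mdnf m F)"
        unfolding sat_assignments_def by simp
    qed
  qed
  then show ?thesis
    by (rule bij_betw_same_card)
qed

lemma ID_image: "ID ((`) f ` F) = (`) f ` ID F"
  by (simp add: ID_def image_UN image_Pow_surj[OF refl])

lemma alpha_le:
  fixes F :: "nat set set"
  assumes "finite F" "\<forall>S\<in>F. finite S" "card (ID F) = k"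
  shows "alpha k \<le> card F"
  unfolding alpha_def using assms by (intro Least_le) blast

text \<open>The \<open>LEAST\<close> in \<open>alpha\<close> is a true minimum only once some family
  with an ideal of size \<open>k\<close> is exhibited.\<close>

lemma alpha_attained:
  assumes "k > 0"
  obtains F :: "nat set set"
  where "finite F" "\<forall>S\<in>F. finite S" "card (ID F) = k" "card F = alpha k"
proof -
  \<comment> \<open>The empty set and \<open>k - 1\<close> singletons form a downward closed family,
    which is its own ideal and has \<open>k\<close> members.\<close>
  define G where "G = insert {} ((\<lambda>i. {i}) ` {1..<k})"
  have "ID G = G"
    by (auto simp: ID_def G_def)
  moreover have "card G = k"
    using assms by (auto simp: G_def card_insert_if card_image)
  moreover have "finite G" "\<forall>S\<in>G. finite S"
    by (auto simp: G_def)
  ultimately have "\<exists>t. \<exists>F :: nat set set.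
      finite F \<and> (\<forall>S\<in>F. finite S) \<and> card (ID F) = k \<and> card F = t"
    by metis
  then have "\<exists>F :: nat set set.
      finite F \<and> (\<forall>S\<in>F. finite S) \<and> card (ID F) = k \<and> card F = alpha k"
    unfolding alpha_def by (rule LeastI_ex)
  then show ?thesis
    using that by blast
qed

text \<open>By the involution, \<phi> is the formula of its family of complemented terms, and that
  family competes in the minimum defining \<open>alpha\<close>.\<close>

lemma alpha_le_card_mdnf:
  assumes "mdnf_over m \<phi>"
  shows "alpha (card (sat_assignments m \<phi>)) \<le> card \<phi>"
proof -
  have \<phi>: "finite \<phi>" "\<phi> \<subseteq> Pow {1..m}"
    using assms by (auto simp: mdnf_over_def)
  let ?F = "family_mdnf m \<phi>"
  have F: "?F \<subseteq> Pow {1..m}" "finite ?F"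
    using \<phi> by (auto simp: family_mdnf_def)
  have "card (ID ?F) = card (sat_assignments m \<phi>)"
    using card_sat_assignments_family_mdnf[OF F(1)] family_mdnf_involution[OF \<phi>(2)] by simp
  moreover have "\<forall>S\<in>?F. finite S"
    by (simp add: family_mdnf_def)
  ultimately have "alpha (card (sat_assignments m \<phi>)) \<le> card ?F"
    using F(2) by (intro alpha_le) auto
  then show ?thesis
    by (simp add: card_family_mdnf[OF \<phi>(2)])
qed

text \<open>An optimal family is relabelled to lie inside some \<open>{1..m}\<close> and then turned
  into its formula.\<close>

lemma alpha_attained_by_mdnf:
  assumes "k > 0"
  obtains m \<phi> where "mdnf_over m \<phi>" "card (sat_assignments m \<phi>) = k" "card \<phi> = alpha k"
proof -
  obtain F :: "nat set set" where F: "finite F" "\<forall>S\<in>F. finite S" "card (ID F) = k"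
      "card F = alpha k"
    using alpha_attained[OF assms] by blast
  \<comment> \<open>The shift by \<^const>\<open>Suc\<close> is needed because \<open>0\<close> is not a variable index.\<close>
  define F' where "F' = (`) Suc ` F"
  \<comment> \<open>Injectivity on sets keeps both the size of the family and the size of its ideal
    under the shift.\<close>
  have inj: "inj_on ((`) Suc) A" for A :: "nat set set"
    by (auto simp: inj_on_def inj_image_eq_iff)
  have "finite (\<Union>F)"
    using F by auto
  then obtain m where "\<Union>F \<subseteq> {..<m}"
    unfolding finite_nat_set_iff_bounded by blast
  then have F': "F' \<subseteq> Pow {1..m}"
    by (fastforce simp: F'_def)
  have "card (ID F') = k" "card F' = alpha k"
    using F by (simp_all add: F'_def ID_image card_image[OF inj])
  moreover have "finite F'"
    using F by (simp add: F'_def)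
  ultimately show ?thesis
    using F' by (intro that[of m "family_mdnf m F'"])
      (simp_all add: mdnf_over_family_mdnf card_sat_assignments_family_mdnf card_family_mdnf)
qed

theorem theorem8:
  fixes k :: nat
  assumes "k > 0"
  shows "(\<forall>(m::nat) (F :: nat set set).
            finite F \<and> F \<subseteq> Pow {1..m} \<and> card (ID F) = k \<longrightarrow>
              mdnf_over m (family_mdnf m F) \<and>
              card (family_mdnf m F) = card F \<and>
              card (sat_assignments m (family_mdnf m F)) = k) \<and>
         (\<exists>m \<phi>. min_mdnf k m \<phi>) \<and>
         (\<forall>m \<phi>. min_mdnf k m \<phi> \<longrightarrow> card \<phi> = alpha k)"
proof -
  obtain m \<phi> where \<phi>: "mdnf_over m \<phi>" "card (sat_assignments m \<phi>) = k" "card \<phi> = alpha k"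
    using alpha_attained_by_mdnf[OF assms] by blast
  \<comment> \<open>The lower bound \<open>alpha k\<close> holds for competitors in any number of
    variables.\<close>
  have "min_mdnf k m \<phi>"
    unfolding min_mdnf_def using \<phi> alpha_le_card_mdnf by metis
  moreover have "card \<psi> = alpha k" if \<psi>: "min_mdnf k n \<psi>" for n \<psi>
  proof (rule antisym)
    \<comment> \<open>Here \<phi> is itself a competitor of \<psi>, although \<open>m\<close> and
      \<open>n\<close> may differ.\<close>
    show "card \<psi> \<le> alpha k"
      using \<psi> \<phi> unfolding min_mdnf_def by metis
    show "alpha k \<le> card \<psi>"
      using alpha_le_card_mdnf[of n \<psi>] \<psi> unfolding min_mdnf_def by simp
  qed
  moreover have "mdnf_over n (family_mdnf n F) \<and> card (family_mdnf n F) = card F \<and>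
      card (sat_assignments n (family_mdnf n F)) = k"
    if "finite F \<and> F \<subseteq> Pow {1..n} \<and> card (ID F) = k" for n F
    using that by (simp add: mdnf_over_family_mdnf card_family_mdnf
        card_sat_assignments_family_mdnf)
  ultimately show ?thesis
    by blast
qed

end
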